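(* Let $C_1, C_2, C_3, C_4$ be four disks in the Euclidean plane $\mathbb{R}^2$, where the $i$-th disk has center $(x_i,y_i)\in\mathbb{R}^2$ and (signed) radius $r_i\in\mathbb{R}\setminus\{0\}$. Let $f$ be the real $4\times 4$ configuration matrix with entries $$f_{ij} = \frac{d_{ij}^2 - r_i^2 - r_j^2}{2 r_i r_j},\qquad d_{ij}^2=(x_i-x_j)^2+(y_i-y_j)^2,\qquad 1\le i,j\le 4,$$ and suppose that $f$ is invertible, with inverse $F = f^{-1}$. Let $D$ be the real $4\times 4$ matrix whose $i$-th column is the vector $$\begin{bmatrix} x_i/r_i \\ y_i/r_i \\ 1/r_i \\ (x_i^2+y_i^2-r_i^2)/r_i\end{bmatrix},\qquad i=1,2,3,4,$$ and let $$G = \begin{bmatrix} -1 & 0 & 0 & 0 \\ 0 & -1 & 0 & 0 \\ 0 & 0 & 0 & 2 \\ 0 & 0 & 2 & 0 \end{bmatrix}.$$ Then $$D\,F\,D^{\mathrm T} = G.$$ In particular, the vector of the four curvatures $B = [\,1/r_1,\ 1/r_2,\ 1/r_3,\ 1/r_4\,]^{\mathrm T}$ satisfies $$B^{\mathrm T} F B = 0.$$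
   Context: A disk of positive radius $r$ is the usual bounded disk; a disk with negative radius $r$ and center $(x,y)$ denotes the unbounded region outside the circle of radius $|r|$ centered at $(x,y)$. The curvature of a disk of signed radius $r$ is $1/r$. The matrix $G$ is the inverse $g^{-1}$ of the matrix of the Minkowski quadratic form $$g = \begin{bmatrix} -1 & 0 & 0 & 0 \\ 0 & -1 & 0 & 0 \\ 0 & 0 & 0 & 1/2 \\ 0 & 0 & 1/2 & 0 \end{bmatrix}.$$ The entry $f_{ij}$ is the scalar product $\langle C_i,C_j\rangle$ of the disks $C_i$ and $C_j$; in particular $f_{ii}=-1$. *)

theory Defs
  imports "HOL-Analysis.Analysis"
begin

(* The radius is signed: for radius > 0 this is the usual bounded disk, for radius < 0 it is the
   unbounded region outside the circle of radius |radius| around the center. Radius 0 is not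
   excluded by the type and has to be excluded by a hypothesis. *)
datatype disk = Disk (center: "real^2") (radius: real)

definition curvature :: "disk \<Rightarrow> real" where
  "curvature C = 1 / radius C"

definition disk_product :: "disk \<Rightarrow> disk \<Rightarrow> real" where
  "disk_product C C' =
     (((center C $ 1 - center C' $ 1)^2 + (center C $ 2 - center C' $ 2)^2)
       - (radius C)^2 - (radius C')^2) / (2 * radius C * radius C')"

definition disk_vector :: "disk \<Rightarrow> real^4" where
  "disk_vector C = vector
     [center C $ 1 / radius C,
      center C $ 2 / radius C,
      1 / radius C,
      ((center C $ 1)^2 + (center C $ 2)^2 - (radius C)^2) / radius C]"

definition configuration_matrix :: "(4 \<Rightarrow> disk) \<Rightarrow> real^4^4" where
  "configuration_matrix C = (\<chi> i j. disk_product (C i) (C j))"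

(* The disk vectors are the columns: the second index is the disk. *)
definition disk_matrix :: "(4 \<Rightarrow> disk) \<Rightarrow> real^4^4" where
  "disk_matrix C = (\<chi> k i. disk_vector (C i) $ k)"

definition minkowski_form :: "real^4^4" where
  "minkowski_form = vector
     [vector [-1,  0,   0,   0],
      vector [ 0, -1,   0,   0],
      vector [ 0,  0,   0, 1/2],
      vector [ 0,  0, 1/2,   0]]"

definition minkowski_inverse :: "real^4^4" where
  "minkowski_inverse = vector
     [vector [-1,  0, 0, 0],
      vector [ 0, -1, 0, 0],
      vector [ 0,  0, 0, 2],
      vector [ 0,  0, 2, 0]]"

(* In type 4 the indices are 1, 2, 3 and 4 = 0, and list position k is component k. *)
lemma vector_4 [simp]:
  "(vector [a, b, c, d] :: ('a::zero)^4) $ 1 = a"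
  "(vector [a, b, c, d] :: ('a::zero)^4) $ 2 = b"
  "(vector [a, b, c, d] :: ('a::zero)^4) $ 3 = c"
  "(vector [a, b, c, d] :: ('a::zero)^4) $ 4 = d"
  unfolding vector_def by simp_all

lemma minkowski_inverse_eq: "minkowski_inverse = matrix_inv minkowski_form"
proof -
  have *: "minkowski_form ** minkowski_inverse = mat 1"
    "minkowski_inverse ** minkowski_form = mat 1"
    by (simp_all add: vec_eq_iff forall_4 matrix_matrix_mult_def sum_4 mat_def
        minkowski_form_def minkowski_inverse_def)
  then have "invertible minkowski_form"
    unfolding invertible_def by blast
  then have "matrix_inv minkowski_form ** minkowski_form = mat 1"
    using someI_ex[of "\<lambda>A'. minkowski_form ** A' = mat 1 \<and> A' ** minkowski_form = mat 1"]
    unfolding invertible_def matrix_inv_def by blast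
  then show ?thesis
    using * by (metis matrix_mul_assoc matrix_mul_lid matrix_mul_rid)
qed

lemma disk_product_self: "radius C \<noteq> 0 \<Longrightarrow> disk_product C C = -1"
  by (simp add: disk_product_def power2_eq_square field_simps)

end

(* The configuration matrix is the Gram matrix f = D^T g D of the disk vectors with respect to the
   Minkowski form g. Hence F D^T g is a left inverse of D; for square matrices it is then also a
   right inverse, so (D F D^T) g = 1 and D F D^T = G. The curvatures form the third row of D, so
   B^T F B is the (3,3) entry of G, which vanishes. *)
theory Submission
  imports Defs
begin

lemma minkowski_form_inverse: "minkowski_form ** minkowski_inverse = mat 1"
  by (simp add: vec_eq_iff forall_4 matrix_matrix_mult_def sum_4 mat_def
      minkowski_form_def minkowski_inverse_def)

text \<open>With q = x^2 + y^2 - r^2, the off-diagonal halves of the form contribute (q + q') / (2 r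
  r') and the entries -1 contribute -(x x' + y y') / (r r'). Completing the squares in the sum gives
  the squared distance of the centers.\<close>

lemma disk_product_eq_minkowski:
  assumes "radius C \<noteq> 0" "radius C' \<noteq> 0"
  shows "disk_product C C' = disk_vector C \<bullet> (minkowski_form *v disk_vector C')"
  using assms
  by (simp add: disk_product_def disk_vector_def minkowski_form_def inner_vec_def
      matrix_vector_mult_def sum_4 field_simps power2_eq_square)

text \<open>Serves twice: with \<open>A\<close> as \<open>D\<close> for the Gram matrix, and with
  \<open>A\<close> as \<open>transpose D\<close> to read a quadratic form in a row of
  \<open>D\<close> off a diagonal entry.\<close>

lemma matrix_mult_inner:
  fixes A :: "real^'n^'m" and g :: "real^'m^'m"
  shows "(transpose A ** g ** A) $ i $ j = column i A \<bullet> (g *v column j A)"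
  unfolding matrix_mul_assoc[symmetric]
  by (simp add: matrix_matrix_mult_def matrix_vector_mult_def transpose_def column_def inner_vec_def)

lemma configuration_matrix_eq_gram:
  assumes "\<And>i. radius (C i) \<noteq> 0"
  shows "configuration_matrix C = transpose (disk_matrix C) ** minkowski_form ** disk_matrix C"
proof -
  have "column i (disk_matrix C) = disk_vector (C i)" for i
    by (simp add: column_def disk_matrix_def vec_eq_iff)
  then show ?thesis
    by (subst vec_eq_iff)+ (simp add: matrix_mult_inner configuration_matrix_def
        disk_product_eq_minkowski assms)
qed

lemma gram_inverse:
  fixes D F g G :: "'a::field^'n^'n"
  assumes "F ** (transpose D ** g ** D) = mat 1" and "g ** G = mat 1"
  shows "D ** F ** transpose D = G"
proof -
  have "(F ** transpose D ** g) ** D = mat 1"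
    using assms(1) by (simp add: matrix_mul_assoc)
  then have "D ** (F ** transpose D ** g) = mat 1"
    by (simp add: matrix_left_right_inverse)
  then have "(D ** F ** transpose D) ** g = mat 1"
    by (simp add: matrix_mul_assoc)
  \<comment> \<open>Multiplying by \<open>G\<close> on the right cancels \<open>g\<close>.\<close>
  then show ?thesis
    using assms(2) by (metis matrix_mul_assoc matrix_mul_lid matrix_mul_rid)
qed

theorem mainTheorem1:
  fixes C :: "4 \<Rightarrow> disk" and f F D :: "real^4^4" and B :: "real^4"
  assumes "\<And>i. radius (C i) \<noteq> 0"
    and "f = configuration_matrix C"
    and "invertible f"
    and "F = matrix_inv f"
    and "D = disk_matrix C"
    and "B = (\<chi> i. curvature (C i))"
  shows "D ** F ** transpose D = minkowski_inverse \<and> B \<bullet> (F *v B) = 0"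
proof
  \<comment> \<open>\<open>matrix_inv\<close> is a Hilbert choice; invertibility of \<open>f\<close>
    provides the witness that makes the chosen matrix an inverse.\<close>
  have "F ** f = mat 1"
    using assms(3,4) someI_ex[of "\<lambda>A'. f ** A' = mat 1 \<and> A' ** f = mat 1"]
    by (simp add: invertible_def matrix_inv_def)
  then show G: "D ** F ** transpose D = minkowski_inverse"
    using assms(1,2,5) minkowski_form_inverse
    by (intro gram_inverse) (simp_all add: configuration_matrix_eq_gram)
  \<comment> \<open>The third component of each disk vector is 1/r, its curvature.\<close>
  have "B = column 3 (transpose D)"
    by (simp add: assms(5,6) column_def transpose_def disk_matrix_def disk_vector_def
        curvature_def vec_eq_iff)
  then have "B \<bullet> (F *v B) = (D ** F ** transpose D) $ 3 $ 3"
    using matrix_mult_inner[of "transpose D" F 3 3] by simp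
  then show "B \<bullet> (F *v B) = 0"
    by (simp add: G minkowski_inverse_def)
qed

end
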